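(* Consider a constant product pool with liquidity $L>0$ and initial marginal price $P_0>0$. For any positive trade volume $\Delta x>0$, the marginal price deviation strictly exceeds the execution slippage: $\Delta p>S(L)$. This geometric divergence demonstrates that stabilizing $S(L)$ at the saturation threshold $L_{sat}$ is entirely insufficient to neutralize exposure to loss-versus-rebalancing (LVR).
   Context: A constant product pool with liquidity $L>0$ has reserves $x,y>0$ with $xy=L^2$; its marginal price is $P_0=y/x$, so $x=L/\sqrt{P_0}$ and $y=L\sqrt{P_0}$. A (fee-free) trade of size $\Delta x>0$ adds $\Delta x$ to the first reserve and removes $\Delta y$ from the second, where $(x+\Delta x)(y-\Delta y)=L^2$. The effective price is $P_{eff}=\Delta y/\Delta x$ and the execution slippage is $$S(L)=\frac{P_0-P_{eff}}{P_0}=\frac{\Delta x}{x+\Delta x}=\frac{K}{L+K},\qquad K=\Delta x\sqrt{P_0}.$$ The new marginal price after the trade is $P_{new}=\dfrac{y-\Delta y}{x+\Delta x}$, and the marginal price deviation is $$\Delta p=\frac{P_0-P_{new}}{P_0}.$$ The saturation threshold $L_{sat}$ is the liquidity depth at which the marginal reduction in slippage falls below a negligible constant $\epsilon>0$, i.e. $\left|\frac{dS}{dL}\right|=\frac{K}{(L+K)^2}\le\epsilon$, which gives $L_{sat}\ge\sqrt{K/\epsilon}-K$. Loss-versus-rebalancing (LVR) is the adverse selection cost borne by liquidity providers against arbitrageurs who trade on the pool's stale marginal price; in continuous time it is $\mathrm{LVR}_t=\int_0^t\frac{\sigma_s^2}{8}V(P_s)\,ds$, where $\sigma_s$ is the instantaneous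 volatility and $V(P_s)$ the pool value at marginal price $P_s$. In the second sentence of the claim, the reason is that execution slippage $S(L)$ is the cost faced by a trader, whereas arbitrageurs extracting LVR exploit the post-trade marginal price, whose shift is $\Delta p$. That sentence is an interpretive conclusion drawn from the inequality. *)

theory Defs
  imports "HOL-Analysis.Analysis"
begin

definition is_pool :: "real \<Rightarrow> real \<Rightarrow> real \<Rightarrow> bool" where
  "is_pool L x y \<longleftrightarrow> 0 < L \<and> 0 < x \<and> 0 < y \<and> x * y = L\<^sup>2"

definition marginal_price :: "real \<Rightarrow> real \<Rightarrow> real" where
  "marginal_price x y = y / x"

text \<open>A pool is parametrised by its liquidity \<open>L\<close> and its marginal price \<open>P\<close>, which determine
  the reserves; see \<open>pool_reserves_iff\<close>.\<close>

definition reserve_x :: "real \<Rightarrow> real \<Rightarrow> real" where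
  "reserve_x L P = L / sqrt P"

definition reserve_y :: "real \<Rightarrow> real \<Rightarrow> real" where
  "reserve_y L P = L * sqrt P"

lemma pool_reserves_iff:
  assumes "0 < L" "0 < P"
  shows "is_pool L x y \<and> marginal_price x y = P \<longleftrightarrow> x = reserve_x L P \<and> y = reserve_y L P"
proof
  assume "is_pool L x y \<and> marginal_price x y = P"
  then have x: "0 < x" and xy: "x * y = L\<^sup>2" and y: "y = P * x"
    by (auto simp: is_pool_def marginal_price_def field_simps)
  have "(x * sqrt P)\<^sup>2 = L\<^sup>2"
    using xy y assms by (simp add: power2_eq_square algebra_simps)
  then have "x * sqrt P = L"
    using x assms by (simp add: power2_eq_iff_nonneg)
  then show "x = reserve_x L P \<and> y = reserve_y L P"
    using y assms by (auto simp: reserve_x_def reserve_y_def field_simps)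
next
  assume "x = reserve_x L P \<and> y = reserve_y L P"
  then show "is_pool L x y \<and> marginal_price x y = P"
    using assms
    by (auto simp: is_pool_def marginal_price_def reserve_x_def reserve_y_def power2_eq_square)
qed

text \<open>The amount \<open>\<Delta>y\<close> paid out for \<open>dx\<close>, i.e. the solution of the invariant equation in
  \<open>amount_out_iff\<close>.\<close>

definition amount_out :: "real \<Rightarrow> real \<Rightarrow> real \<Rightarrow> real" where
  "amount_out L P dx = reserve_y L P - L\<^sup>2 / (reserve_x L P + dx)"

lemma amount_out_iff:
  assumes "0 < L" "0 < P" "0 < dx"
  shows "(reserve_x L P + dx) * (reserve_y L P - dy) = L\<^sup>2 \<longleftrightarrow> dy = amount_out L P dx"
proof -
  have "0 < reserve_x L P + dx"
    using assms by (simp add: reserve_x_def add_pos_pos)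
  then show ?thesis
    by (auto simp: amount_out_def field_simps)
qed

definition effective_price :: "real \<Rightarrow> real \<Rightarrow> real \<Rightarrow> real" where
  "effective_price L P dx = amount_out L P dx / dx"

definition slippage :: "real \<Rightarrow> real \<Rightarrow> real \<Rightarrow> real" where
  "slippage P dx L = (P - effective_price L P dx) / P"

definition new_price :: "real \<Rightarrow> real \<Rightarrow> real \<Rightarrow> real" where
  "new_price L P dx =
     marginal_price (reserve_x L P + dx) (reserve_y L P - amount_out L P dx)"

definition price_deviation :: "real \<Rightarrow> real \<Rightarrow> real \<Rightarrow> real" where
  "price_deviation P dx L = (P - new_price L P dx) / P"

text \<open>With \<open>K = dx * sqrt P\<close>, the threshold \<open>L\<^sub>s\<^sub>a\<^sub>t = sqrt (K / \<epsilon>) - K\<close> is the least depth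
  satisfying this predicate if it is positive; otherwise every positive depth satisfies it.
  See \<open>saturated_iff\<close>.\<close>

definition saturated :: "real \<Rightarrow> real \<Rightarrow> real \<Rightarrow> real \<Rightarrow> bool" where
  "saturated P dx \<epsilon> L \<longleftrightarrow> 0 < L \<and> \<bar>deriv (slippage P dx) L\<bar> \<le> \<epsilon>"

lemma slippage_closed_form:
  assumes "0 < L" "0 < P" "0 < dx"
  shows "slippage P dx L = dx * sqrt P / (L + dx * sqrt P)"
proof -
  define s where "s = sqrt P"
  have s: "0 < s" "P = s * s" using assms by (auto simp: s_def)
  have pos: "0 < L + dx * s" using assms s by (simp add: add_pos_pos)
  have "L / s + dx = (L + dx * s) / s" using s by (simp add: field_simps)
  then have "amount_out L P dx = L * s - L\<^sup>2 * s / (L + dx * s)"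
    by (simp add: amount_out_def reserve_x_def reserve_y_def s_def)
  also have "\<dots> = L * P * dx / (L + dx * s)"
    using pos by (simp add: s(2) field_simps power2_eq_square)
  finally have "effective_price L P dx = L * P / (L + dx * s)"
    using assms by (simp add: effective_price_def)
  then have "slippage P dx L = 1 - L / (L + dx * s)"
    using assms by (simp add: slippage_def diff_divide_distrib)
  also have "\<dots> = dx * s / (L + dx * s)"
    using pos by (simp add: field_simps)
  finally show ?thesis by (simp add: s_def)
qed

lemma saturated_iff:
  assumes "0 < P" "0 < dx" "0 < \<epsilon>"
  defines "K \<equiv> dx * sqrt P"
  shows "saturated P dx \<epsilon> L \<longleftrightarrow> 0 < L \<and> sqrt (K / \<epsilon>) - K \<le> L"
proof (cases "0 < L")
  case True
  have K: "0 < K" using assms by simp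
  have "((\<lambda>L. K / (L + K)) has_field_derivative - (K / (L + K)\<^sup>2)) (at L)"
    using True K by (auto intro!: derivative_eq_intros simp: power2_eq_square)
  moreover have "\<forall>\<^sub>F M in nhds L. slippage P dx M = K / (M + K)"
    using eventually_nhds_in_open[of "{0<..}" L] True assms
    by (auto simp: slippage_closed_form elim!: eventually_mono)
  ultimately have "(slippage P dx has_field_derivative - (K / (L + K)\<^sup>2)) (at L)"
    by (subst DERIV_cong_ev) auto
  then have "deriv (slippage P dx) L = - (K / (L + K)\<^sup>2)"
    by (rule DERIV_imp_deriv)
  then have "saturated P dx \<epsilon> L \<longleftrightarrow> K / (L + K)\<^sup>2 \<le> \<epsilon>"
    using True K by (simp add: saturated_def)
  also have "\<dots> \<longleftrightarrow> K / \<epsilon> \<le> (L + K)\<^sup>2"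
    using True K assms(3) by (simp add: field_simps)
  also have "\<dots> \<longleftrightarrow> sqrt (K / \<epsilon>) \<le> L + K"
    using True K by (metis add_pos_pos less_imp_le real_sqrt_le_iff real_sqrt_unique)
  finally show ?thesis using True by auto
qed (simp add: saturated_def)

end

theory Submission imports Defs
begin

text \<open>A trade scales the first reserve by \<open>1 / (1 - S)\<close>, hence the second by \<open>1 - S\<close>, so the
  marginal price is scaled by \<open>(1 - S)\<^sup>2\<close>. Thus \<open>\<Delta>p = 1 - (1 - S)\<^sup>2 = S + S (1 - S)\<close>,
  which exceeds \<open>S\<close> since \<open>0 < S < 1\<close>; this holds at every positive depth, saturated or not.\<close>

lemma slippage_pos:
  assumes "0 < L" "0 < P" "0 < dx"
  shows "0 < slippage P dx L"
  using assms by (simp add: slippage_closed_form add_pos_pos)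

lemma slippage_less_1:
  assumes "0 < L" "0 < P" "0 < dx"
  shows "slippage P dx L < 1"
  using assms by (simp add: slippage_closed_form add_pos_pos)

lemma price_deviation_eq:
  assumes "0 < L" "0 < P" "0 < dx"
  shows "price_deviation P dx L = 1 - (1 - slippage P dx L)\<^sup>2"
proof -
  define s where "s = sqrt P"
  have s: "0 < s" "P = s\<^sup>2" using assms by (auto simp: s_def)
  have pos: "0 < L + dx * s" using assms s by (simp add: add_pos_pos)
  have "L / s + dx = (L + dx * s) / s" using s by (simp add: field_simps)
  \<comment> \<open>The payout leaves \<open>L\<^sup>2 / (L / s + dx)\<close> in the second reserve,
    so the new price is the square of \<open>L / (L / s + dx)\<close>.\<close>
  then have "new_price L P dx = s\<^sup>2 * (L / (L + dx * s))\<^sup>2"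
    by (simp add: new_price_def marginal_price_def amount_out_def reserve_x_def
        s_def[symmetric] power2_eq_square)
  then have "new_price L P dx = P * (L / (L + dx * s))\<^sup>2"
    by (simp only: s(2))
  moreover have "1 - slippage P dx L = L / (L + dx * s)"
    using assms pos by (simp add: slippage_closed_form s_def[symmetric] field_simps)
  ultimately show ?thesis
    using assms by (simp add: price_deviation_def diff_divide_distrib)
qed

lemma slippage_less_price_deviation:
  assumes "0 < L" "0 < P" "0 < dx"
  shows "slippage P dx L < price_deviation P dx L"
proof -
  have "0 < slippage P dx L * (1 - slippage P dx L)"
    using slippage_pos[OF assms] slippage_less_1[OF assms] by simp
  then show ?thesis
    by (simp add: price_deviation_eq[OF assms] power2_eq_square algebra_simps)
qed

text \<open>The second conjunct is the mathematical content of the LVR sentence: saturation leaves a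
  positive slippage and a still larger price shift, the one arbitrageurs exploit.\<close>

theorem lemma6:
  fixes L P\<^sub>0 dx :: real
  assumes "0 < L" and "0 < P\<^sub>0" and "0 < dx"
  shows "price_deviation P\<^sub>0 dx L > slippage P\<^sub>0 dx L \<and>
    (\<forall>\<epsilon> L\<^sub>s. 0 < \<epsilon> \<and> saturated P\<^sub>0 dx \<epsilon> L\<^sub>s \<longrightarrow>
       0 < slippage P\<^sub>0 dx L\<^sub>s \<and> slippage P\<^sub>0 dx L\<^sub>s < price_deviation P\<^sub>0 dx L\<^sub>s)"
  \<comment> \<open>\<open>saturated\<close> supplies \<open>0 < L\<^sub>s\<close>, so the bounds
    for a general depth apply at \<open>L\<^sub>s\<close>.\<close>
  using assms by (auto simp: saturated_def slippage_pos slippage_less_price_deviation)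

end
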